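(* Let $X$ be a complex Banach space with the analytic Radon-Nikodym property and let $\mathcal{D}\subset X$ be a strictly convex bounded domain. Then for any two distinct points $p,q\in\mathcal{D}$ there exists at most one normalized complex geodesic in $\mathcal{D}$ joining $p$ and $q$.
   Context: $\mathbb{D}$ is the open unit disc in $\mathbb{C}$ and $\rho(z,w)=\tanh^{-1}\left|\frac{z-w}{1-\bar w z}\right|$ is the Poincaré distance. $H(\mathcal{D}_1,\mathcal{D}_2)$ is the set of holomorphic maps from $\mathcal{D}_1$ to $\mathcal{D}_2$. The Carathéodory distance on $\mathcal{D}$ is $C_{\mathcal{D}}(p,q)=\sup\{\rho(f(p),f(q)): f\in H(\mathcal{D},\mathbb{D})\}$. A map $\phi\in H(\mathbb{D},\mathcal{D})$ is a complex geodesic if $\rho(u,v)=C_{\mathcal{D}}(\phi(u),\phi(v))$ for all $u,v\in\mathbb{D}$. It is a normalized complex geodesic joining $p$ and $q$ ($p\neq q$) if $\phi(0)=p$ and $\phi(s)=q$ for some positive real number $s$ (necessarily $s=\tanh C_{\mathcal{D}}(p,q)$). A complex Banach space $X$ has the analytic Radon-Nikodym property if each bounded holomorphic function $f:\mathbb{D}\to X$ has (norm) radial limits $\lim_{r\to1^-}f(re^{i\theta})$ at almost every point $e^{i\theta}$ of the unit circle. A convex domain $\mathcal{D}$ is strictly convex if each point of the boundary $\partial\mathcal{D}$ is a (real) extreme point of the closure $\overline{\mathcal{D}}$. *)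

theory Defs
  imports "HOL-Complex_Analysis.Complex_Analysis"
begin

text \<open>The complex structure is added on top of the real Banach space structure of the library,
  so that Frechet derivatives, segments and extreme points are the library's (real) notions.\<close>

class complex_normed_vector = real_normed_vector +
  fixes scaleC :: "complex \<Rightarrow> 'a \<Rightarrow> 'a" (infixr \<open>*\<^sub>C\<close> 75)
  assumes scaleC_add_right: "a *\<^sub>C (x + y) = a *\<^sub>C x + a *\<^sub>C y"
    and scaleC_add_left: "(a + b) *\<^sub>C x = a *\<^sub>C x + b *\<^sub>C x"
    and scaleC_scaleC: "a *\<^sub>C (b *\<^sub>C x) = (a * b) *\<^sub>C x"
    and scaleC_of_real: "complex_of_real r *\<^sub>C x = r *\<^sub>R x"
    and norm_scaleC: "norm (a *\<^sub>C x) = cmod a * norm x"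

class complex_banach = complex_normed_vector + banach

instantiation complex :: complex_banach
begin

definition scaleC_complex :: "complex \<Rightarrow> complex \<Rightarrow> complex"
  where "scaleC_complex a z = a * z"

instance
  by standard (simp_all add: scaleC_complex_def algebra_simps norm_mult scaleR_conv_of_real)

end

text \<open>Holomorphy is complex Frechet differentiability at every point; it is meant for open
  sets only.\<close>

definition holo_on ::
    "('a::complex_normed_vector \<Rightarrow> 'b::complex_normed_vector) \<Rightarrow> 'a set \<Rightarrow> bool"
  where "holo_on f S \<longleftrightarrow>
    (\<forall>x\<in>S. \<exists>f'. (f has_derivative f') (at x) \<and> (\<forall>c v. f' (c *\<^sub>C v) = c *\<^sub>C f' v))"

lemma holo_on_complex_iff:
  fixes f :: "complex \<Rightarrow> complex"
  assumes "open S"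
  shows "holo_on f S \<longleftrightarrow> f holomorphic_on S"
proof
  assume h: "holo_on f S"
  show "f holomorphic_on S"
    unfolding holomorphic_on_open[OF assms]
  proof
    fix x assume "x \<in> S"
    then obtain f' where f': "(f has_derivative f') (at x)" "\<forall>c v. f' (c *\<^sub>C v) = c *\<^sub>C f' v"
      using h unfolding holo_on_def by blast
    have "f' = (*) (f' 1)"
    proof
      fix v
      have "f' (v *\<^sub>C 1) = v *\<^sub>C f' 1" using f'(2) by blast
      then show "f' v = f' 1 * v" by (simp add: scaleC_complex_def mult.commute)
    qed
    then show "\<exists>d. (f has_field_derivative d) (at x)"
      using f'(1) unfolding has_field_derivative_def by metis
  qed
next
  assume "f holomorphic_on S"
  then have "\<forall>x\<in>S. \<exists>d. (f has_derivative (*) d) (at x)"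
    unfolding holomorphic_on_open[OF assms] has_field_derivative_def .
  moreover have "\<forall>c v. d * (c *\<^sub>C v) = c *\<^sub>C (d * v)" for d :: complex
    by (simp add: scaleC_complex_def)
  ultimately show "holo_on f S"
    unfolding holo_on_def by blast
qed

abbreviation unit_disc :: "complex set"
  where "unit_disc \<equiv> ball 0 1"

text \<open>Maps are total functions, of which only the values on \<open>D\<close> matter.\<close>

definition holo_maps ::
    "'a::complex_normed_vector set \<Rightarrow> 'b::complex_normed_vector set \<Rightarrow> ('a \<Rightarrow> 'b) set"
  where "holo_maps D E = {f. holo_on f D \<and> f ` D \<subseteq> E}"

definition poincare_dist :: "complex \<Rightarrow> complex \<Rightarrow> real"
  where "poincare_dist z w = artanh (cmod ((z - w) / (1 - cnj w * z)))"

text \<open>The supremum is taken in the reals; it is that of a nonempty bounded set whenever \<open>D\<close> is a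
  domain containing \<open>p\<close> and \<open>q\<close>.\<close>

definition caratheodory_dist :: "'a::complex_normed_vector set \<Rightarrow> 'a \<Rightarrow> 'a \<Rightarrow> real"
  where "caratheodory_dist D p q = (SUP f\<in>holo_maps D unit_disc. poincare_dist (f p) (f q))"

definition complex_geodesic :: "'a::complex_normed_vector set \<Rightarrow> (complex \<Rightarrow> 'a) \<Rightarrow> bool"
  where "complex_geodesic D \<phi> \<longleftrightarrow> \<phi> \<in> holo_maps unit_disc D \<and>
    (\<forall>u\<in>unit_disc. \<forall>v\<in>unit_disc. poincare_dist u v = caratheodory_dist D (\<phi> u) (\<phi> v))"

definition normalized_complex_geodesic ::
    "'a::complex_normed_vector set \<Rightarrow> 'a \<Rightarrow> 'a \<Rightarrow> (complex \<Rightarrow> 'a) \<Rightarrow> bool"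
  where "normalized_complex_geodesic D p q \<phi> \<longleftrightarrow>
    complex_geodesic D \<phi> \<and> \<phi> 0 = p \<and> (\<exists>s::real. 0 < s \<and> s < 1 \<and> \<phi> (of_real s) = q)"

definition analytic_RNP :: "'a::complex_normed_vector itself \<Rightarrow> bool"
  where "analytic_RNP X \<longleftrightarrow>
    (\<forall>f :: complex \<Rightarrow> 'a. holo_on f unit_disc \<and> bounded (f ` unit_disc) \<longrightarrow>
      (AE t in lebesgue_on {0..2*pi}. \<exists>l. ((\<lambda>r. f (of_real r * cis t)) \<longlongrightarrow> l) (at_left 1)))"

definition is_domain :: "'a::real_normed_vector set \<Rightarrow> bool"
  where "is_domain D \<longleftrightarrow> open D \<and> connected D \<and> D \<noteq> {}"

definition strictly_convex_domain :: "'a::real_normed_vector set \<Rightarrow> bool"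
  where "strictly_convex_domain D \<longleftrightarrow>
    is_domain D \<and> convex D \<and> (\<forall>x\<in>frontier D. x extreme_point_of closure D)"

end

theory Submission
  imports Defs
begin

text \<open>Let \<open>\<theta> = (\<phi> + \<psi>) / 2\<close>, a map into \<open>D\<close> with \<open>\<theta> 0 = p\<close> and \<open>\<theta> s = q\<close>. If \<open>F\<^sub>n\<close> are maps from \<open>D\<close>
  to the disc with \<open>F\<^sub>n p = 0\<close> that are near-extremal for the Caratheodory distance of \<open>p\<close> and \<open>q\<close>,
  then \<open>\<bar>F\<^sub>n (\<theta> z)\<bar>\<close> tends to \<open>\<bar>z\<bar>\<close> along a subsequence, for every \<open>z\<close>. Near a point of \<open>D\<close>, on the
  other hand, all such maps are bounded by a common constant below 1. So a radial limit of \<open>\<theta>\<close> lies on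
  the boundary of \<open>D\<close>, and being the midpoint of the corresponding radial limits of \<open>\<phi>\<close> and \<open>\<psi>\<close> it
  forces these to be equal by strict convexity. A bounded holomorphic function with vanishing radial
  limits almost everywhere is zero; the vector-valued case follows from the Hahn-Banach theorem.\<close>

subsection \<open>Hahn-Banach functionals\<close>

text \<open>An inequality suffices in the scaling law: applying it to the factor \<open>1/t\<close>
  as well gives equality for every \<open>t \<ge> 0\<close>. This form is easier to verify for
  infima.\<close>

definition sublinear :: "('a::real_vector \<Rightarrow> real) \<Rightarrow> bool"
  where "sublinear p \<longleftrightarrow> (\<forall>x y. p (x + y) \<le> p x + p y) \<and> (\<forall>t\<ge>0. \<forall>x. p (t *\<^sub>R x) \<le> t * p x)"

lemma sublinear_add: "sublinear p \<Longrightarrow> p (x + y) \<le> p x + p y"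
  and sublinear_scale_le: "sublinear p \<Longrightarrow> t \<ge> 0 \<Longrightarrow> p (t *\<^sub>R x) \<le> t * p x"
  by (auto simp: sublinear_def)

lemma sublinear_0: assumes "sublinear p" shows "p 0 = 0"
  using sublinear_add[OF assms, of 0 0] sublinear_scale_le[OF assms, of 0 0] by simp

lemma sublinear_scale:
  assumes "sublinear p" "t \<ge> 0"
  shows "p (t *\<^sub>R x) = t * p x"
proof (cases "t = 0")
  case False
  with assms have "t > 0" by simp
  moreover have "p ((1/t) *\<^sub>R (t *\<^sub>R x)) \<le> (1/t) * p (t *\<^sub>R x)"
    using assms by (intro sublinear_scale_le) auto
  ultimately have "t * p x \<le> p (t *\<^sub>R x)"
    by (simp add: field_simps)
  then show ?thesis
    using sublinear_scale_le[OF assms, of x] by linarith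
qed (simp add: sublinear_0[OF assms(1)])

lemma sublinear_minus: assumes "sublinear p" shows "- p (- x) \<le> p x"
  using sublinear_add[OF assms, of x "-x"] sublinear_0[OF assms] by simp

lemma sublinear_norm: "sublinear norm"
  by (simp add: sublinear_def norm_triangle_ineq)

text \<open>The infimum below is the largest sublinear \<open>q \<le> p\<close> with \<open>q (- y) \<le> - p y\<close>.\<close>
lemma sublinear_shift:
  assumes p: "sublinear p"
  obtains q where "sublinear q" "\<And>x. q x \<le> p x" "q (- y) \<le> - p y"
proof -
  define q where "q x = (INF t\<in>{0..}. p (x + t *\<^sub>R y) - t * p y)" for x
  \<comment> \<open>The real infimum is meaningful only once a lower bound is known; it comes from
    cancelling \<open>x\<close> in \<open>p (x + t *\<^sub>R y + - x)\<close>.\<close>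
  have bdd: "bdd_below ((\<lambda>t. p (x + t *\<^sub>R y) - t * p y) ` {0..})" for x
  proof (rule bdd_belowI2)
    fix t :: real assume "t \<in> {0..}"
    then have "t * p y = p (x + t *\<^sub>R y + - x)"
      using sublinear_scale[OF p] by simp
    also have "\<dots> \<le> p (x + t *\<^sub>R y) + p (- x)"
      by (rule sublinear_add[OF p])
    finally show "- p (- x) \<le> p (x + t *\<^sub>R y) - t * p y" by simp
  qed
  have q_le: "q x \<le> p (x + t *\<^sub>R y) - t * p y" if "t \<ge> 0" for x t
    unfolding q_def by (rule cINF_lower[OF bdd]) (use that in auto)
  have le_q: "a \<le> q x" if "\<And>t. t \<ge> 0 \<Longrightarrow> a \<le> p (x + t *\<^sub>R y) - t * p y" for a x
    unfolding q_def by (rule cINF_greatest) (use that in auto)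
  have "q (x + x') \<le> q x + q x'" for x x'
  proof -
    \<comment> \<open>The two infima are removed one after the other; parameters \<open>s\<close>
      and \<open>t\<close> combine to the admissible parameter \<open>s + t\<close> for the
      sum.\<close>
    have "q (x + x') - q x \<le> q x'"
    proof (rule le_q)
      fix t :: real assume t: "t \<ge> 0"
      have "q (x + x') - (p (x' + t *\<^sub>R y) - t * p y) \<le> q x"
      proof (rule le_q)
        fix s :: real assume s: "s \<ge> 0"
        have "q (x + x') \<le> p ((x + s *\<^sub>R y) + (x' + t *\<^sub>R y)) - (s + t) * p y"
          using q_le[of "s + t" "x + x'"] s t by (simp add: algebra_simps)
        also have "\<dots> \<le> p (x + s *\<^sub>R y) + p (x' + t *\<^sub>R y) - (s + t) * p y"
          using sublinear_add[OF p] by (intro diff_right_mono)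
        finally show "q (x + x') - (p (x' + t *\<^sub>R y) - t * p y) \<le> p (x + s *\<^sub>R y) - s * p y"
          by (simp add: algebra_simps)
      qed
      then show "q (x + x') - q x \<le> p (x' + t *\<^sub>R y) - t * p y" by simp
    qed
    then show ?thesis by simp
  qed
  moreover have "q (c *\<^sub>R x) \<le> c * q x" if "c \<ge> 0" for c x
  proof (cases "c = 0")
    case True
    then show ?thesis using q_le[of 0 0] sublinear_0[OF p] by simp
  next
    case False
    with that have c: "c > 0" by simp
    have "q (c *\<^sub>R x) / c \<le> q x"
    proof (rule le_q)
      fix t :: real assume t: "t \<ge> 0"
      have "q (c *\<^sub>R x) \<le> p (c *\<^sub>R (x + t *\<^sub>R y)) - (c * t) * p y"
        using q_le[of "c * t" "c *\<^sub>R x"] t c by (simp add: algebra_simps)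
      also have "\<dots> = c * (p (x + t *\<^sub>R y) - t * p y)"
        using sublinear_scale[OF p, of c "x + t *\<^sub>R y"] c by (simp add: right_diff_distrib)
      finally show "q (c *\<^sub>R x) / c \<le> p (x + t *\<^sub>R y) - t * p y"
        using c by (simp add: field_simps)
    qed
    then show ?thesis using c by (simp add: field_simps)
  qed
  ultimately have "sublinear q" by (auto simp: sublinear_def)
  moreover have "q x \<le> p x" for x using q_le[of 0 x] by simp
  \<comment> \<open>At parameter 1 the argument \<open>- y + y\<close> vanishes, leaving only
    \<open>- p y\<close>.\<close>
  moreover have "q (- y) \<le> - p y" using q_le[of 1 "- y"] sublinear_0[OF p] by simp
  ultimately show thesis by (rule that)
qed

text \<open>Minimality identifies \<open>p\<close> with its shift along every \<open>y\<close>, so that \<open>p (- y) = - p y\<close>.\<close>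
lemma minimal_sublinear_linear:
  assumes p: "sublinear p"
    and min: "\<And>q. sublinear q \<Longrightarrow> (\<And>x. q x \<le> p x) \<Longrightarrow> q = p"
  shows "linear p"
proof -
  have neg: "p (- y) = - p y" for y
  proof -
    obtain q where q: "sublinear q" "\<And>x. q x \<le> p x" "q (- y) \<le> - p y"
      using sublinear_shift[OF p] by blast
    with min have "q = p" by blast
    with q(3) sublinear_minus[OF p, of y] show ?thesis by simp
  qed
  show ?thesis
  proof (rule linearI)
    show "p (x + y) = p x + p y" for x y
      using sublinear_add[OF p, of x y] sublinear_add[OF p, of "x + y" "- y"] neg[of y] by simp
    show "p (c *\<^sub>R x) = c *\<^sub>R p x" for c x
    proof (cases "c \<ge> 0")
      case True
      then show ?thesis using sublinear_scale[OF p] by simp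
    next
      case False
      then have "p ((- c) *\<^sub>R x) = (- c) * p x" by (intro sublinear_scale[OF p]) simp
      then show ?thesis using neg[of "c *\<^sub>R x"] by simp
    qed
  qed
qed

text \<open>Lower bounds for Zorn's lemma. The common majorant \<open>r\<close> keeps the pointwise
  infimum finite, by \<open>- r (- x) \<le> f x\<close>. Comparability gives subadditivity: the
  smaller of \<open>f\<close> and \<open>g\<close> can be used at both points.\<close>

lemma sublinear_INF_chain:
  assumes C: "C \<noteq> {}" "\<And>f. f \<in> C \<Longrightarrow> sublinear f" "\<And>f x. f \<in> C \<Longrightarrow> f x \<le> r x"
    and chain: "\<And>f g. f \<in> C \<Longrightarrow> g \<in> C \<Longrightarrow> (\<forall>x. f x \<le> g x) \<or> (\<forall>x. g x \<le> f x)"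
  obtains u where "sublinear u" "\<And>f x. f \<in> C \<Longrightarrow> u x \<le> f x"
proof -
  define u where "u x = (INF f\<in>C. f x)" for x
  have "- r (- x) \<le> f x" if "f \<in> C" for f x
    using sublinear_minus[OF C(2)[OF that], of x] C(3)[OF that, of "- x"] by linarith
  then have u_le: "u x \<le> f x" if "f \<in> C" for f x
    unfolding u_def by (rule cINF_lower[OF bdd_belowI2 that])
  have le_u: "a \<le> u x" if "\<And>f. f \<in> C \<Longrightarrow> a \<le> f x" for a x
    unfolding u_def by (rule cINF_greatest[OF C(1) that])
  have "u (x + y) \<le> u x + u y" for x y
  proof -
    have "u (x + y) - u x \<le> u y"
    proof (rule le_u)
      fix g assume g: "g \<in> C"
      have "u (x + y) - g y \<le> u x"
      proof (rule le_u)
        fix f assume f: "f \<in> C"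
        show "u (x + y) - g y \<le> f x"
          using chain[OF f g]
        proof
          assume "\<forall>x. f x \<le> g x"
          then show ?thesis
            using u_le[OF f, of "x + y"] sublinear_add[OF C(2)[OF f], of x y] by (smt (verit))
        next
          assume "\<forall>x. g x \<le> f x"
          then show ?thesis
            using u_le[OF g, of "x + y"] sublinear_add[OF C(2)[OF g], of x y] by (smt (verit))
        qed
      qed
      then show "u (x + y) - u x \<le> g y" by simp
    qed
    then show ?thesis by simp
  qed
  moreover have "u (c *\<^sub>R x) \<le> c * u x" if c: "c \<ge> 0" for c x
  proof (cases "c = 0")
    case True
    obtain f where "f \<in> C" using C(1) by blast
    with True show ?thesis using u_le[of f 0] sublinear_0[OF C(2)] by force
  next
    case False
    with c have "c > 0" by simp
    have "u (c *\<^sub>R x) / c \<le> u x"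
    proof (rule le_u)
      fix f assume f: "f \<in> C"
      show "u (c *\<^sub>R x) / c \<le> f x"
        using u_le[OF f, of "c *\<^sub>R x"] sublinear_scale[OF C(2)[OF f] c, of x] \<open>c > 0\<close>
        by (simp add: field_simps)
    qed
    then show ?thesis using \<open>c > 0\<close> by (simp add: field_simps)
  qed
  ultimately have "sublinear u" by (auto simp: sublinear_def)
  then show thesis using u_le that by blast
qed

text \<open>Zorn's lemma yields a minimal sublinear function below \<open>r\<close>, and minimal
  ones are linear.\<close>

lemma linear_below_sublinear:
  assumes r: "sublinear r"
  obtains l where "linear l" "\<And>x. l x \<le> r x"
proof -
  let ?A = "{q. sublinear q \<and> (\<forall>x. q x \<le> r x)}"
  \<comment> \<open>The order is reversed, so that a maximal element in Zorn's lemma is a pointwise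
    minimal function.\<close>
  let ?P = "\<lambda>f g. \<forall>x. g x \<le> (f x :: real)"
  have "\<exists>m\<in>?A. \<forall>a\<in>?A. ?P m a \<longrightarrow> a = m"
  proof (rule predicate_Zorn)
    show "partial_order_on ?A (relation_of ?P ?A)"
      by (rule partial_order_on_relation_ofI) (auto intro: order_trans simp: fun_eq_iff order_antisym)
    fix C assume C: "C \<in> Chains (relation_of ?P ?A)"
    show "\<exists>u\<in>?A. \<forall>a\<in>C. ?P a u"
    proof (cases "C = {}")
      case True
      then show ?thesis using r by blast
    next
      case False
      have CA: "f \<in> ?A" if "f \<in> C" for f
        using C that unfolding Chains_def relation_of_def by blast
      have "(\<forall>x. f x \<le> g x) \<or> (\<forall>x. g x \<le> f x)" if "f \<in> C" "g \<in> C" for f g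
        using C that unfolding Chains_def relation_of_def by blast
      then obtain u where u: "sublinear u" "\<And>f x. f \<in> C \<Longrightarrow> u x \<le> f x"
        using sublinear_INF_chain[of C r] False CA by blast
      obtain f where "f \<in> C" using False by blast
      then have "u x \<le> r x" for x
        using u(2) CA order_trans by blast
      then show ?thesis using u by blast
    qed
  qed
  then obtain l where l: "l \<in> ?A" and min: "\<And>q. q \<in> ?A \<Longrightarrow> (\<forall>x. q x \<le> l x) \<Longrightarrow> q = l"
    by blast
  have "linear l"
  proof (rule minimal_sublinear_linear)
    fix q assume "sublinear q" and ql: "\<And>x. q x \<le> l x"
    moreover have "q x \<le> r x" for x using ql l order_trans by blast
    ultimately show "q = l" by (intro min) auto
  qed (use l in auto)
  with l show thesis using that by blast
qed

text \<open>Shifting the norm along \<open>x0\<close> builds the inequality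
  \<open>l (- x0) \<le> - norm x0\<close> into every linear \<open>l\<close> below the shift, while
  \<open>l \<le> norm\<close> gives the opposite bound and continuity.\<close>

lemma norming_functional:
  fixes x0 :: "'a::real_normed_vector"
  obtains l :: "'a \<Rightarrow> real" where "bounded_linear l" "l x0 = norm x0"
proof -
  obtain q where q: "sublinear q" "\<And>x. q x \<le> norm x" "q (- x0) \<le> - norm x0"
    using sublinear_shift[OF sublinear_norm] by blast
  obtain l where l: "linear l" "\<And>x. l x \<le> q x"
    using linear_below_sublinear[OF q(1)] by blast
  have le: "l x \<le> norm x" for x using l(2) q(2) order_trans by blast
  have neg: "l (- x) = - l x" for x using l(1) by (simp add: linear_neg)
  have "\<bar>l x\<bar> \<le> norm x" for x using le[of x] le[of "- x"] neg[of x] by simp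
  then have "bounded_linear l"
    by (intro linear_conv_bounded_linear[THEN iffD1] bounded_linear.intro)
       (use l(1) in \<open>auto simp: bounded_linear_axioms_def linear_conv_bounded_linear intro!: exI[of _ 1]\<close>)
  moreover have "l x0 = norm x0"
    using le[of x0] l(2)[of "- x0"] q(3) neg[of x0] by simp
  ultimately show thesis by (rule that)
qed

section \<open>Complex-linear norming functionals\<close>

lemma bounded_linear_scaleC_right: "bounded_linear (\<lambda>x :: 'a::complex_normed_vector. c *\<^sub>C x)"
proof (rule bounded_linear_intro[where K = "cmod c"])
  show "c *\<^sub>C (r *\<^sub>R x) = r *\<^sub>R (c *\<^sub>C x)" for r and x :: 'a
    by (simp flip: scaleC_of_real add: scaleC_scaleC mult.commute)
qed (auto simp: scaleC_add_right norm_scaleC mult.commute)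

text \<open>A real functional \<open>l\<close> is the real part of the complex-linear functional
  sending \<open>x\<close> to \<open>l x - i l (i x)\<close>. Control of the real part at
  \<open>x0\<close> is enough to conclude \<open>x0 = 0\<close> from
  \<open>L x0 = 0\<close>.\<close>

lemma complex_norming_functional:
  fixes x0 :: "'a::complex_normed_vector"
  obtains L :: "'a \<Rightarrow> complex"
  where "bounded_linear L" "\<And>c x. L (c *\<^sub>C x) = c * L x" "Re (L x0) = norm x0"
proof -
  obtain l :: "'a \<Rightarrow> real" where l: "bounded_linear l" "l x0 = norm x0"
    by (rule norming_functional)
  interpret l: bounded_linear l by fact
  define L where "L x = of_real (l x) - \<i> * of_real (l (\<i> *\<^sub>C x))" for x
  have "bounded_linear L"
    unfolding L_def
    by (intro bounded_linear_sub bounded_linear_const_mult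
        bounded_linear_compose[OF bounded_linear_of_real] l
        bounded_linear_compose[OF l(1) bounded_linear_scaleC_right])
  moreover have "L (c *\<^sub>C x) = c * L x" for c x
  proof -
    have expand: "c *\<^sub>C x = Re c *\<^sub>R x + Im c *\<^sub>R (\<i> *\<^sub>C x)" for c and x :: 'a
      by (simp flip: scaleC_of_real add: scaleC_scaleC scaleC_add_left[symmetric] mult.commute)
         (simp add: complex_eq[symmetric])
    have "\<i> *\<^sub>C (c *\<^sub>C x) = Re c *\<^sub>R (\<i> *\<^sub>C x) - Im c *\<^sub>R x"
      using expand[of "\<i> * c" x] by (simp add: scaleC_scaleC)
    then show ?thesis
      unfolding L_def using expand[of c x]
      by (simp add: l.add l.diff l.scaleR complex_eq_iff)
  qed
  moreover have "Re (L x0) = norm x0" by (simp add: L_def l(2))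
  ultimately show thesis by (rule that)
qed

subsection \<open>Holomorphic maps and Schwarz estimates\<close>

lemma holo_on_compose:
  assumes "holo_on f S" "f ` S \<subseteq> T" "holo_on g T"
  shows "holo_on (\<lambda>x. g (f x)) S"
  unfolding holo_on_def
proof
  fix x assume x: "x \<in> S"
  obtain f' where f': "(f has_derivative f') (at x)" "\<And>c v. f' (c *\<^sub>C v) = c *\<^sub>C f' v"
    using assms(1) x unfolding holo_on_def by blast
  obtain g' where g': "(g has_derivative g') (at (f x))" "\<And>c v. g' (c *\<^sub>C v) = c *\<^sub>C g' v"
    using assms(2,3) x unfolding holo_on_def by blast
  show "\<exists>h'. ((\<lambda>x. g (f x)) has_derivative h') (at x) \<and> (\<forall>c v. h' (c *\<^sub>C v) = c *\<^sub>C h' v)"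
    using has_derivative_compose[OF f'(1) g'(1)] f'(2) g'(2) by (intro exI[of _ "\<lambda>v. g' (f' v)"]) auto
qed

lemma holo_on_complex_linear:
  assumes "bounded_linear L" "\<And>c v. L (c *\<^sub>C v) = c *\<^sub>C L v"
  shows "holo_on L S"
  using bounded_linear_imp_has_derivative[OF assms(1)] assms(2) unfolding holo_on_def by blast

lemma holo_on_add:
  assumes "holo_on f S" "holo_on g S"
  shows "holo_on (\<lambda>x. f x + g x) S"
  unfolding holo_on_def
proof
  fix x assume x: "x \<in> S"
  obtain f' where f': "(f has_derivative f') (at x)" "\<And>c v. f' (c *\<^sub>C v) = c *\<^sub>C f' v"
    using assms(1) x unfolding holo_on_def by blast
  obtain g' where g': "(g has_derivative g') (at x)" "\<And>c v. g' (c *\<^sub>C v) = c *\<^sub>C g' v"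
    using assms(2) x unfolding holo_on_def by blast
  show "\<exists>h'. ((\<lambda>x. f x + g x) has_derivative h') (at x) \<and> (\<forall>c v. h' (c *\<^sub>C v) = c *\<^sub>C h' v)"
    using has_derivative_add[OF f'(1) g'(1)] f'(2) g'(2) 
    by (intro exI[of _ "\<lambda>v. f' v + g' v"]) (auto simp: scaleC_add_right)
qed

lemma scaleC_zero_right [simp]: "c *\<^sub>C (0::'a::complex_normed_vector) = 0"
  using norm_scaleC[of c "0::'a"] by simp

lemma scaleC_zero_left [simp]: "0 *\<^sub>C (x::'a::complex_normed_vector) = 0"
  using norm_scaleC[of 0 x] by simp

lemma scaleC_one [simp]: "1 *\<^sub>C (x::'a::complex_normed_vector) = x"
  using scaleC_of_real[of 1 x] by simp

lemma holo_on_const: "holo_on (\<lambda>x. a) S"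
  unfolding holo_on_def by (auto intro!: exI[of _ "\<lambda>x. 0"])

lemma holo_on_scaleC:
  assumes "holo_on f S"
  shows "holo_on (\<lambda>x. c *\<^sub>C f x) S"
  by (rule holo_on_compose[OF assms subset_UNIV])
     (auto intro!: holo_on_complex_linear bounded_linear_scaleC_right simp: scaleC_scaleC mult.commute)

lemma bounded_linear_scaleC_left: "bounded_linear (\<lambda>c. c *\<^sub>C (x :: 'a::complex_normed_vector))"
proof (rule bounded_linear_intro[where K = "norm x"])
  show "(r *\<^sub>R c) *\<^sub>C x = r *\<^sub>R (c *\<^sub>C x)" for r c
    by (metis scaleC_of_real scaleC_scaleC scaleR_conv_of_real)
qed (auto simp: scaleC_add_left norm_scaleC)

lemma holo_on_scaleC_left:
  assumes "h holomorphic_on S" "open S"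
  shows "holo_on (\<lambda>z. h z *\<^sub>C v) S"
  by (rule holo_on_compose[OF holo_on_complex_iff[OF assms(2), THEN iffD2, OF assms(1)] subset_UNIV])
     (auto intro!: holo_on_complex_linear bounded_linear_scaleC_left simp: scaleC_scaleC scaleC_complex_def)

lemma holomorphic_on_holo_compose:
  assumes "holo_on f S" "open S" "f ` S \<subseteq> T" "holo_on g T"
  shows "(\<lambda>z. g (f z)) holomorphic_on S"
  using holo_on_compose[OF assms(1,3,4)] holo_on_complex_iff[OF assms(2)] by blast

section \<open>Slices by complex lines and bounds uniform over maps into the disc\<close>

lemma convex_affine_scaleC_vimage:
  fixes D :: "'a::complex_normed_vector set"
  assumes "convex D"
  shows "convex {z. p + z *\<^sub>C v \<in> D}"
proof -
  interpret bounded_linear "\<lambda>z. z *\<^sub>C v" by (rule bounded_linear_scaleC_left)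
  have "{z. p + z *\<^sub>C v \<in> D} = (\<lambda>z. z *\<^sub>C v) -` ((\<lambda>x. x - p) ` D)"
    by (force simp: image_iff algebra_simps)
  then show ?thesis
    using assms by (simp add: convex_linear_vimage[OF linear_axioms] convex_translation_subtract_eq)
qed

lemma open_affine_scaleC_vimage:
  fixes D :: "'a::complex_normed_vector set"
  assumes "open D"
  shows "open {z. p + z *\<^sub>C v \<in> D}"
proof -
  have "continuous_on UNIV (\<lambda>z. p + z *\<^sub>C v)"
    by (intro continuous_intros bounded_linear.continuous_on[OF bounded_linear_scaleC_left])
  from open_vimage[OF assms this] show ?thesis by (simp add: vimage_def)
qed

text \<open>The domain is pulled back to a bounded convex planar set containing 0 and 1, which the
  Riemann mapping theorem identifies with the disc; Schwarz' lemma then gives the bound.\<close>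
lemma holo_maps_disc_bound:
  fixes D :: "'a::complex_normed_vector set"
  assumes D: "open D" "convex D" and p: "p \<in> D" and x: "x \<in> D"
  obtains c where "c < 1" "\<And>F. F \<in> holo_maps D unit_disc \<Longrightarrow> F p = 0 \<Longrightarrow> cmod (F x) \<le> c"
proof -
  \<comment> \<open>Parameter 0 stands for \<open>p\<close> and 1 for \<open>x\<close>. The ball of
    radius 2 contains both parameters and makes the slice a proper subset of the plane, even if
    \<open>D\<close> contains the whole complex line.\<close>
  define \<Omega> where "\<Omega> = {z. p + z *\<^sub>C (x - p) \<in> D} \<inter> ball 0 2"
  have \<Omega>: "open \<Omega>" "convex \<Omega>" "0 \<in> \<Omega>" "1 \<in> \<Omega>"
    using D p x unfolding \<Omega>_def
    by (auto intro!: convex_Int convex_affine_scaleC_vimage open_affine_scaleC_vimage)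
  moreover have "3 \<notin> \<Omega>" by (simp add: \<Omega>_def)
  ultimately obtain f g where fg: "g holomorphic_on ball 0 1"
    "\<And>z. z \<in> \<Omega> \<Longrightarrow> f z \<in> ball 0 1 \<and> g (f z) = z" "\<And>z. z \<in> ball 0 1 \<Longrightarrow> g z \<in> \<Omega>"
    using Riemann_mapping_theorem[of \<Omega>] convex_imp_simply_connected[of \<Omega>] by (metis UNIV_I empty_iff)
  \<comment> \<open>The Riemann map need not fix 0; an automorphism \<open>h\<close> of the disc
    with inverse \<open>k\<close> moves \<open>f 0\<close> to 0.\<close>
  obtain h k where hk: "h (f 0) = 0" "h ` ball 0 1 \<subseteq> ball 0 1" "k holomorphic_on ball 0 1"
    "k ` ball 0 1 \<subseteq> ball 0 1" "\<And>z. z \<in> ball 0 1 \<Longrightarrow> k (h z) = z"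
    using ball_biholomorphism_exists[of "f 0"] fg(2)[OF \<Omega>(3)] by metis
  define a where "a = h (f 1)"
  have f01: "f 0 \<in> ball 0 1" "f 1 \<in> ball 0 1" using fg(2) \<Omega> by blast+
  have a: "a \<in> ball 0 1" "g (k a) = 1" "g (k 0) = 0"
    unfolding a_def using hk(1) subsetD[OF hk(2) imageI[OF f01(2)]] hk(5)[of "f 1"] hk(5)[of "f 0"] f01 fg(2)[of 1] fg(2)[of 0] \<Omega> by auto
  have gk: "(\<lambda>z. g (k z)) holomorphic_on ball 0 1"
    using holomorphic_on_compose_gen[OF hk(3) fg(1) hk(4)] by (simp add: o_def)
  \<comment> \<open>An analytic disc in \<open>D\<close> with \<open>u 0 = p\<close> and
    \<open>u a = x\<close>. It is built without reference to \<open>F\<close>, so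
    \<open>cmod a\<close> bounds all \<open>F\<close> at once.\<close>
  define u where "u z = p + g (k z) *\<^sub>C (x - p)" for z
  have u: "holo_on u (ball 0 1)"
    unfolding u_def using gk by (intro holo_on_add holo_on_const holo_on_scaleC_left) auto
  have uD: "u ` ball 0 1 \<subseteq> D"
    using hk(4) fg(3) by (force simp: u_def \<Omega>_def)
  show thesis
  proof
    show "cmod a < 1" using a(1) by simp
    fix F assume F: "F \<in> holo_maps D unit_disc" "F p = 0"
    have hol: "(\<lambda>z. F (u z)) holomorphic_on ball 0 1"
      using F uD by (intro holomorphic_on_holo_compose[OF u]) (auto simp: holo_maps_def)
    have "cmod (F (u a)) \<le> cmod a"
    proof (rule Schwarz_Lemma(1)[OF hol])
      show "cmod (F (u z)) < 1" if "cmod z < 1" for z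
        using F(1) uD that by (force simp: holo_maps_def)
    qed (use F(2) a in \<open>auto simp: u_def\<close>)
    then show "cmod (F x) \<le> cmod a" by (simp add: u_def a)
  qed
qed

text \<open>Schwarz' lemma on the slice of the ball by the complex line through \<open>x\<close> and
  \<open>y\<close>. The constant depends on \<open>d\<close> alone, which makes the family of all
  such \<open>F\<close> equicontinuous at \<open>x\<close>.\<close>

lemma holo_maps_disc_Lipschitz:
  fixes D :: "'a::complex_normed_vector set"
  assumes F: "F \<in> holo_maps D unit_disc" and ball: "ball x d \<subseteq> D" and y: "y \<in> ball x d"
  shows "cmod (F y - F x) \<le> 2 * norm (y - x) / d"
proof (cases "y = x")
  case False
  define R where "R = norm (y - x)"
  have R: "0 < R" "R < d" using False y by (auto simp: R_def dist_norm norm_minus_commute)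
  \<comment> \<open>The factor \<open>d / R\<close> stretches the unit disc to radius
    \<open>d\<close>, so that \<open>y\<close> has parameter \<open>R / d\<close>.\<close>
  define u where "u z = x + (z * of_real (d / R)) *\<^sub>C (y - x)" for z
  have uD: "u z \<in> ball x d" if "cmod z < 1" for z
  proof -
    have "norm (u z - x) = cmod z * d" using R by (simp add: u_def norm_scaleC norm_mult R_def[symmetric] norm_divide)
    also have "\<dots> < 1 * d" using that R by (intro mult_strict_right_mono) auto
    finally show ?thesis by (simp add: dist_norm norm_minus_commute)
  qed
  have "holo_on u (ball 0 1)"
    unfolding u_def by (intro holo_on_add holo_on_const holo_on_scaleC_left holomorphic_intros) auto
  then have hol: "(\<lambda>z. F (u z)) holomorphic_on ball 0 1"
    using F uD ball by (intro holomorphic_on_holo_compose[of u _ D]) (auto simp: holo_maps_def)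
  have F1: "cmod (F (u z)) < 1" if "cmod z < 1" for z
    using F uD[OF that] ball by (force simp: holo_maps_def)
  have u0: "u 0 = x" and uR: "u (of_real (R / d)) = y"
    using R by (simp_all add: u_def)
  \<comment> \<open>Two values in the disc differ by less than 2; halving the difference returns it
    to the disc.\<close>
  have "cmod ((F (u (of_real (R / d))) - F (u 0)) / 2) \<le> cmod (of_real (R / d))"
  proof (rule Schwarz_Lemma(1))
    show "(\<lambda>z. (F (u z) - F (u 0)) / 2) holomorphic_on ball 0 1"
      using hol by (intro holomorphic_intros) auto
    show "cmod ((F (u z) - F (u 0)) / 2) < 1" if "cmod z < 1" for z
      using norm_triangle_ineq4[of "F (u z)" "F (u 0)"] F1[OF that] F1[of 0] by (simp add: norm_divide)
    show "cmod (of_real (R / d)) < 1" using R by (simp add: norm_divide)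
  qed simp
  then have "cmod ((F y - F x) / 2) \<le> R / d"
    unfolding u0 uR using R by (simp add: norm_divide)
  then show ?thesis by (simp add: norm_divide R_def mult.commute)
qed simp

subsection \<open>Radial limits and uniqueness of geodesics\<close>

text \<open>Cauchy's formula on circles with radii tending to 1 expresses \<open>g w\<close> by
  integrals whose integrands tend to 0 almost everywhere; boundedness of \<open>g\<close> permits
  dominated convergence.\<close>

lemma bounded_holomorphic_radial_limits_0:
  assumes hol: "g holomorphic_on ball 0 1" and bdd: "bounded (g ` ball 0 1)"
    and lim: "AE t in lebesgue_on {0..2*pi}. ((\<lambda>r. g (of_real r * cis t)) \<longlongrightarrow> 0) (at_left 1)"
    and w: "w \<in> ball 0 1"
  shows "g w = 0"
proof -
  obtain B where B: "\<And>z. z \<in> ball 0 1 \<Longrightarrow> cmod (g z) \<le> B"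
    using bdd unfolding bounded_iff by blast
  \<comment> \<open>The radii start halfway between \<open>cmod w\<close> and 1 and tend to 1, so
    all the circles keep distance at least \<open>(1 - cmod w) / 2\<close> from
    \<open>w\<close>.\<close>
  define r where "r n = 1 - ((1 - cmod w) / 2) / real (Suc n)" for n
  have w1: "cmod w < 1" using w by simp
  have r_le: "(1 + cmod w) / 2 \<le> r n" and r_less: "r n < 1" for n
  proof -
    have "((1 - cmod w) / 2) / real (Suc n) \<le> (1 - cmod w) / 2"
      using w1 divide_left_mono[of 1 "real (Suc n)" "(1 - cmod w) / 2"] by simp
    moreover have "0 < ((1 - cmod w) / 2) / real (Suc n)"
      using w1 by simp
    ultimately show "(1 + cmod w) / 2 \<le> r n" "r n < 1" by (auto simp: r_def field_simps)
  qed
  have r_pos: "0 < r n" for n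
    by (rule less_le_trans[OF _ r_le]) (smt (verit) norm_ge_zero half_gt_zero)
  have w_r: "cmod w < r n" for n using r_le[of n] w1 by simp
  have "r \<longlonglongrightarrow> 1 - 0"
    unfolding r_def by (intro tendsto_diff tendsto_const LIMSEQ_Suc lim_const_over_n)
  then have r_lim: "filterlim r (at_left 1) sequentially"
    unfolding filterlim_at using r_less by (auto simp: less_imp_neq)
  \<comment> \<open>The Cauchy integrand on the circle of radius \<open>r n\<close>, including the
    derivative of the parametrization.\<close>
  define F where "F n t = g (of_real (r n) * cis t) / (of_real (r n) * cis t - w) * of_real (r n) * \<i> * cis t"
    for n t
  have circ: "of_real (r n) * cis t \<in> ball 0 1" for n t
    using r_pos[of n] r_less[of n] by (simp add: norm_mult)
  have denom: "(1 - cmod w) / 2 \<le> cmod (of_real (r n) * cis t - w)" for n t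
  proof -
    have "r n - cmod w \<le> cmod (of_real (r n) * cis t - w)"
      using norm_triangle_ineq2[of "of_real (r n) * cis t" w] r_pos[of n] by (simp add: norm_mult)
    then show ?thesis using r_le[of n] by (simp add: field_simps)
  qed
  have nz: "of_real (r n) * cis t - w \<noteq> 0" for n t
    using denom[of n t] w1 by force
  have cont: "continuous_on {0..2*pi} (F n)" for n
    unfolding F_def
    by (intro continuous_intros continuous_on_compose2[OF holomorphic_on_imp_continuous_on[OF hol]])
       (use circ nz in auto)
  have F_bound: "cmod (F n t) \<le> 2 / (1 - cmod w) * cmod (g (of_real (r n) * cis t))" for n t
  proof -
    have "cmod (F n t) \<le> cmod (g (of_real (r n) * cis t)) / cmod (of_real (r n) * cis t - w)"
      using r_pos[of n] r_less[of n] by (simp add: F_def norm_mult norm_divide mult_left_le divide_right_mono)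
    also have "\<dots> \<le> cmod (g (of_real (r n) * cis t)) / ((1 - cmod w) / 2)"
      using denom w1 by (intro divide_left_mono mult_pos_pos less_le_trans[OF _ denom]) auto
    finally show ?thesis by (simp add: mult.commute)
  qed
  have F_int: "(F n has_integral (2 * of_real pi * \<i> * g w)) {0..2*pi}" for n
  proof -
    have sub: "cball 0 (r n) \<subseteq> ball (0::complex) 1" using r_less[of n] by auto
    have "((\<lambda>u. g u / (u - w)) has_contour_integral (2 * of_real pi * \<i> * g w)) (circlepath 0 (r n))"
      by (rule Cauchy_integral_circlepath)
         (use w_r[of n] sub in \<open>auto intro!: holomorphic_on_imp_continuous_on holomorphic_on_subset[OF hol] dest: less_trans[OF _ r_less]\<close>)
    then show ?thesis
      unfolding circlepath_def by (subst (asm) has_contour_integral_part_circlepath_iff) (auto simp: F_def[abs_def])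
  qed
  have meas: "F n \<in> borel_measurable (lebesgue_on {0..2*pi})" for n
    by (rule continuous_imp_measurable_on_sets_lebesgue[OF cont]) auto
  have "(\<lambda>n. integral\<^sup>L (lebesgue_on {0..2*pi}) (F n)) \<longlonglongrightarrow> integral\<^sup>L (lebesgue_on {0..2*pi}) (\<lambda>t. 0)"
    and int: "integrable (lebesgue_on {0..2*pi}) (F n)" for n
  proof -
    have 1: "AE t in lebesgue_on {0..2*pi}. (\<lambda>n. F n t) \<longlonglongrightarrow> 0"
      using lim
    proof eventually_elim
      fix t assume "((\<lambda>r. g (of_real r * cis t)) \<longlongrightarrow> 0) (at_left 1)"
      from tendsto_mult_right_zero[OF tendsto_norm_zero[OF filterlim_compose[OF this r_lim]], of "2 / (1 - cmod w)"]
      show "(\<lambda>n. F n t) \<longlonglongrightarrow> 0"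
        by (rule Lim_null_comparison[rotated]) (intro always_eventually allI F_bound)
    qed
    have 2: "AE t in lebesgue_on {0..2*pi}. cmod (F n t) \<le> 2 / (1 - cmod w) * B" for n
      using F_bound B[OF circ] w1 by (intro AE_I2 order_trans[OF F_bound] mult_left_mono) auto
    have 3: "integrable (lebesgue_on {0..2*pi}) (\<lambda>t. 2 / (1 - cmod w) * B)"
      by simp
    show "(\<lambda>n. integral\<^sup>L (lebesgue_on {0..2*pi}) (F n)) \<longlonglongrightarrow> integral\<^sup>L (lebesgue_on {0..2*pi}) (\<lambda>t. 0)"
      by (rule integral_dominated_convergence[OF _ meas 3 1 2]) simp
    show "integrable (lebesgue_on {0..2*pi}) (F n)" for n
      by (rule integrable_dominated_convergence2[OF _ meas 3 1 2]) simp
  qed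
  \<comment> \<open>The integrals do not depend on \<open>n\<close>, so their common value equals
    the limit 0.\<close>
  moreover have "integral\<^sup>L (lebesgue_on {0..2*pi}) (F n) = 2 * of_real pi * \<i> * g w" for n
    using lebesgue_integral_eq_integral[OF int] integral_unique[OF F_int] by simp
  ultimately have "2 * of_real pi * \<i> * g w = 0"
    by (simp add: LIMSEQ_const_iff)
  then show ?thesis by simp
qed

section \<open>Near-extremal maps for the Caratheodory distance\<close>

lemma artanh_real_less:
  fixes x y :: real
  assumes "- 1 < x" "x < y" "y < 1"
  shows "artanh x < artanh y"
proof -
  have "(1 + x) / (1 - x) < (1 + y) / (1 - y)"
    using assms by (intro frac_less) auto
  moreover have "0 < (1 + x) / (1 - x)" using assms by simp
  ultimately show ?thesis
    unfolding artanh_def by (intro divide_strict_right_mono) (auto intro: ln_less_cancel_iff[THEN iffD2])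
qed

lemma poincare_dist_0: "0 \<le> s \<Longrightarrow> poincare_dist 0 (of_real s) = artanh s"
  by (simp add: poincare_dist_def)

text \<open>Some competitor beats any value below the supremum. Following it by the Moebius map that
  sends \<open>f p\<close> to 0 preserves the Poincare distance and turns it into
  \<open>artanh\<close> of a modulus.\<close>

lemma near_extremal_holo_map:
  assumes p: "p \<in> D" and q: "q \<in> D" and s: "caratheodory_dist D p q = artanh s" "s < 1"
    and t: "0 \<le> t" "t < s"
  obtains F where "F \<in> holo_maps D unit_disc" "F p = 0" "t < cmod (F q)"
proof -
  have "\<exists>f\<in>holo_maps D unit_disc. artanh t < poincare_dist (f p) (f q)"
  proof (rule ccontr)
    assume "\<not> ?thesis"
    \<comment> \<open>A least-upper-bound argument for the real supremum requires a nonempty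
      family.\<close>
    moreover have "(\<lambda>x. 0) \<in> holo_maps D unit_disc"
      by (auto simp: holo_maps_def holo_on_const)
    ultimately have "caratheodory_dist D p q \<le> artanh t"
      unfolding caratheodory_dist_def by (intro cSUP_least) auto
    then show False using artanh_real_less[of t s] s t by simp
  qed
  then obtain f where f: "f \<in> holo_maps D unit_disc" "artanh t < poincare_dist (f p) (f q)"
    by blast
  have fp: "cmod (f p) < 1" and fq: "cmod (f q) < 1"
    using f(1) p q by (auto simp: holo_maps_def)
  let ?M = "Moebius_function 0 (f p)"
  have fD: "holo_on f D" "f ` D \<subseteq> ball 0 1" using f(1) by (auto simp: holo_maps_def)
  \<comment> \<open>The two quotients agree in modulus: numerators differ by a sign, denominators by
    conjugation.\<close>
  have "cmod ((f p - f q) / (1 - cnj (f q) * f p)) = cmod (?M (f q))"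
  proof -
    have "cmod (1 - cnj (f q) * f p) = cmod (cnj (1 - cnj (f q) * f p))"
      by (simp only: complex_mod_cnj)
    also have "\<dots> = cmod (1 - cnj (f p) * f q)" by (simp add: mult.commute)
    finally show ?thesis
      by (simp add: Moebius_function_simple norm_divide norm_minus_commute)
  qed
  then have "artanh t < artanh (cmod (?M (f q)))"
    using f(2) by (simp add: poincare_dist_def)
  moreover have "cmod (?M (f q)) < 1"
    by (rule Moebius_function_norm_lt_1[OF fp fq])
  ultimately have "t < cmod (?M (f q))"
    using artanh_real_less[of "cmod (?M (f q))" t] s t by (smt (verit) norm_ge_zero)
  moreover have "(\<lambda>x. ?M (f x)) \<in> holo_maps D unit_disc"
  proof -
    have "holo_on ?M (ball 0 1)"
      using Moebius_function_holomorphic[OF fp] holo_on_complex_iff[of "ball 0 1"] by blast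
    from holo_on_compose[OF fD this] show ?thesis
      using fD(2) Moebius_function_norm_lt_1[OF fp] by (force simp: holo_maps_def)
  qed
  ultimately show thesis
    using that[of "\<lambda>x. ?M (f x)"] by (simp add: Moebius_function_eq_zero)
qed

text \<open>By Montel and the equality case of Schwarz' lemma, the compositions of \<open>\<theta>\<close> with near-extremal
  maps subconverge to a rotation of the disc. This avoids having to show that the supremum in the
  Caratheodory distance is attained.\<close>
lemma extremal_sequence:
  assumes \<theta>: "\<theta> \<in> holo_maps unit_disc D" "\<theta> 0 = p" "\<theta> (of_real s) = q"
    and s: "0 < s" "s < 1" "caratheodory_dist D p q = artanh s"
  obtains F :: "nat \<Rightarrow> 'a::complex_normed_vector \<Rightarrow> complex"
  where "\<And>n. F n \<in> holo_maps D unit_disc" "\<And>n. F n p = 0"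
    "\<And>z. z \<in> unit_disc \<Longrightarrow> (\<lambda>n. cmod (F n (\<theta> z))) \<longlonglongrightarrow> cmod z"
proof -
  have \<theta>D: "holo_on \<theta> (ball 0 1)" "\<theta> ` ball 0 1 \<subseteq> D" using \<theta>(1) by (auto simp: holo_maps_def)
  have s_disc: "of_real s \<in> ball (0::complex) 1" using s by simp
  have p: "p \<in> D" and q: "q \<in> D" using \<theta>D(2) \<theta>(2,3) s_disc by force+
  \<comment> \<open>Admissible lower bounds starting at 0 and tending to \<open>s\<close>.\<close>
  define t where "t n = s - s / real (Suc n)" for n
  have "0 \<le> t n" "t n < s" for n using s by (auto simp: t_def field_simps)
  then have "\<exists>F. F \<in> holo_maps D unit_disc \<and> F p = 0 \<and> t n < cmod (F q)" for n
    using near_extremal_holo_map[OF p q s(3,2), of "t n"] by blast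
  then obtain F where F: "\<And>n. F n \<in> holo_maps D unit_disc" "\<And>n. F n p = 0" "\<And>n. t n < cmod (F n q)"
    by metis
  have hol: "(\<lambda>z. F n (\<theta> z)) holomorphic_on ball 0 1" for n
    using F(1) by (intro holomorphic_on_holo_compose[OF \<theta>D(1) _ \<theta>D(2)]) (auto simp: holo_maps_def)
  have F1: "cmod (F n (\<theta> z)) < 1" if "cmod z < 1" for n z
    using F(1)[of n] \<theta>D(2) that by (force simp: holo_maps_def)
  have F_le: "cmod (F n (\<theta> z)) \<le> cmod z" if "cmod z < 1" for n z
    by (rule Schwarz_Lemma(1)[OF hol]) (use F1 F(2) \<theta>(2) that in auto)
  obtain g r where g: "g holomorphic_on ball 0 1" and r: "strict_mono (r :: nat \<Rightarrow> nat)"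
    and lim: "\<And>z. z \<in> ball 0 1 \<Longrightarrow> (\<lambda>n. F (r n) (\<theta> z)) \<longlonglongrightarrow> g z"
  proof (rule Montel[of "ball 0 1" "range (\<lambda>n z. F n (\<theta> z))" "\<lambda>n z. F n (\<theta> z)"])
    show "\<exists>B. \<forall>h\<in>range (\<lambda>n z. F n (\<theta> z)). \<forall>z\<in>K. cmod (h z) \<le> B" if "K \<subseteq> ball 0 1" for K
      using F1 that by (intro exI[of _ 1]) (force intro: less_imp_le)
  qed (use hol in auto)
  have g_le: "cmod (g z) \<le> cmod z" if "cmod z < 1" for z
    by (rule LIMSEQ_le_const2[OF tendsto_norm[OF lim]]) (use F_le that in auto)
  have "t \<longlonglongrightarrow> s - 0"
    unfolding t_def by (intro tendsto_diff tendsto_const LIMSEQ_Suc lim_const_over_n)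
  then have "(\<lambda>n. t (r n)) \<longlonglongrightarrow> s"
    using LIMSEQ_subseq_LIMSEQ[OF _ r] by (simp add: o_def)
  \<comment> \<open>Near-extremality passes to the limit and gives equality in Schwarz' lemma at the
    nonzero point \<open>s\<close>, so \<open>g\<close> is a rotation.\<close>
  then have "s \<le> cmod (g (of_real s))"
    by (rule LIMSEQ_le[OF _ tendsto_norm[OF lim[OF s_disc]]]) (use F(3) \<theta>(3) in \<open>auto intro: less_imp_le\<close>)
  then have "cmod (g (of_real s)) = cmod (of_real s)" using g_le[of "of_real s"] s by simp
  moreover have "g 0 = 0" using g_le[of 0] by simp
  moreover have "cmod (g z) < 1" if "cmod z < 1" for z using g_le that by force
  ultimately obtain \<alpha> where "\<And>z. cmod z < 1 \<Longrightarrow> g z = \<alpha> * z" "cmod \<alpha> = 1"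
    using Schwarz_Lemma(3)[OF g, of 0] s s_disc by (metis mem_ball_0 norm_zero of_real_eq_0_iff zero_less_one less_irrefl)
  then have "(\<lambda>n. cmod (F (r n) (\<theta> z))) \<longlonglongrightarrow> cmod z" if "z \<in> ball 0 1" for z
    using tendsto_norm[OF lim[OF that]] that by (simp add: norm_mult)
  then show thesis using that[of "\<lambda>n. F (r n)"] F by blast
qed

text \<open>If \<open>x\<close> were in \<open>D\<close>, the extremal sequence would be bounded by
  some \<open>c < 1\<close> at \<open>x\<close> and, by equicontinuity, by
  \<open>(1 + c) / 2\<close> near \<open>x\<close>. Along the radius, however, the moduli tend to
  \<open>r\<close>, which exceeds that bound close to 1.\<close>

lemma radial_limit_notin_domain:
  fixes D :: "'a::complex_normed_vector set"
  assumes D: "open D" "convex D"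
    and \<theta>: "\<theta> \<in> holo_maps unit_disc D" "\<theta> 0 = p" "\<theta> (of_real s) = q"
    and s: "0 < s" "s < 1" "caratheodory_dist D p q = artanh s"
    and lim: "((\<lambda>r. \<theta> (of_real r * cis t)) \<longlongrightarrow> x) (at_left 1)"
  shows "x \<notin> D"
proof
  assume x: "x \<in> D"
  obtain F :: "nat \<Rightarrow> 'a \<Rightarrow> complex" where F: "\<And>n. F n \<in> holo_maps D unit_disc" "\<And>n. F n p = 0"
    "\<And>z. z \<in> unit_disc \<Longrightarrow> (\<lambda>n. cmod (F n (\<theta> z))) \<longlonglongrightarrow> cmod z"
    by (rule extremal_sequence[OF \<theta> s]) blast
  have p: "p \<in> D" using \<theta>(1,2) by (force simp: holo_maps_def)
  obtain c where c: "c < 1" "\<And>n. cmod (F n x) \<le> c"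
    using holo_maps_disc_bound[OF D p x] F(1,2) by metis
  obtain d where d: "0 < d" "ball x d \<subseteq> D" using D(1) x open_contains_ball by blast
  \<comment> \<open>Chosen so that the Lipschitz error \<open>2 * e / d\<close> is at most half of
    the gap between \<open>c\<close> and 1.\<close>
  define e where "e = min d (d * (1 - c) / 4)"
  have e: "0 < e" "e \<le> d" "2 * e / d \<le> (1 - c) / 2" using c d by (auto simp: e_def field_simps min_def)
  have "\<forall>\<^sub>F r in at_left 1. dist (\<theta> (of_real r * cis t)) x < e"
    using lim e(1) by (rule tendstoD)
  moreover have "\<forall>\<^sub>F r in at_left 1. r \<in> {max 0 ((1 + c) / 2)<..<1}"
    using c(1) by (intro eventually_at_leftI[of "max 0 ((1 + c) / 2)"]) auto
  ultimately have "\<forall>\<^sub>F r::real in at_left 1. False"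
  proof eventually_elim
    case (elim r)
    then have z: "of_real r * cis t \<in> ball (0::complex) 1" by (simp add: norm_mult)
    have "cmod (F n (\<theta> (of_real r * cis t))) \<le> (1 + c) / 2" for n
    proof -
      let ?y = "\<theta> (of_real r * cis t)"
      have "cmod (F n ?y - F n x) \<le> 2 * norm (?y - x) / d"
        using elim(1) e by (intro holo_maps_disc_Lipschitz[OF F(1) d(2)]) (simp add: dist_commute)
      also have "\<dots> \<le> 2 * e / d"
        using elim(1) d(1) by (intro divide_right_mono) (auto simp: dist_norm)
      finally show ?thesis
        using e(3) c(2)[of n] norm_triangle_ineq2[of "F n ?y" "F n x"] by argo
    qed
    then have "cmod (of_real r * cis t) \<le> (1 + c) / 2"
      by (intro LIMSEQ_le_const2[OF F(3)[OF z]]) auto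
    then show False using elim(2) by (auto simp: norm_mult abs_if split: if_splits)
  qed
  then show False by (simp add: trivial_limit_at_left_real eventually_False)
qed

text \<open>A functional norming \<open>\<phi> z - \<psi> z\<close>, chosen for the given
  \<open>z\<close>, reduces the claim to the scalar case: it preserves holomorphy, boundedness and
  null radial limits.\<close>

lemma holo_eq_if_radial_limits_eq:
  fixes \<phi> \<psi> :: "complex \<Rightarrow> 'a::complex_normed_vector"
  assumes hol: "holo_on \<phi> unit_disc" "holo_on \<psi> unit_disc"
    and bdd: "bounded (\<phi> ` unit_disc)" "bounded (\<psi> ` unit_disc)"
    and lim: "AE t in lebesgue_on {0..2*pi}. ((\<lambda>r. \<phi> (of_real r * cis t) - \<psi> (of_real r * cis t)) \<longlongrightarrow> 0) (at_left 1)"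
    and z: "z \<in> unit_disc"
  shows "\<phi> z = \<psi> z"
proof -
  obtain L :: "'a \<Rightarrow> complex" where L: "bounded_linear L" "\<And>c x. L (c *\<^sub>C x) = c * L x"
    "Re (L (\<phi> z - \<psi> z)) = norm (\<phi> z - \<psi> z)"
    using complex_norming_functional[of "\<phi> z - \<psi> z"] by blast
  interpret L: bounded_linear L by fact
  have holo_L: "holo_on L UNIV"
    by (rule holo_on_complex_linear[OF L(1)]) (simp add: L(2) scaleC_complex_def)
  have "(\<lambda>u. L (\<phi> u)) holomorphic_on ball 0 1" "(\<lambda>u. L (\<psi> u)) holomorphic_on ball 0 1"
    using hol by (auto intro!: holomorphic_on_holo_compose[OF _ _ subset_UNIV holo_L])
  then have "(\<lambda>u. L (\<phi> u - \<psi> u)) holomorphic_on ball 0 1"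
    by (simp add: L.diff holomorphic_on_diff)
  moreover have "bounded ((\<lambda>u. L (\<phi> u - \<psi> u)) ` ball 0 1)"
    using bounded_linear_image[OF bounded_minus_comp[OF bdd] L(1)] by (simp add: image_image)
  moreover have "AE t in lebesgue_on {0..2*pi}.
      ((\<lambda>r. L (\<phi> (of_real r * cis t) - \<psi> (of_real r * cis t))) \<longlongrightarrow> 0) (at_left 1)"
    using lim by eventually_elim (use L.tendsto_zero in blast)
  ultimately have "L (\<phi> z - \<psi> z) = 0"
    using z by (rule bounded_holomorphic_radial_limits_0)
  with L(3) show ?thesis by simp
qed

theorem theorem3p2:
  fixes D :: "'a::complex_banach set" and p q :: 'a
  assumes "analytic_RNP TYPE('a)"
    and "strictly_convex_domain D" and "bounded D"
    and "p \<in> D" and "q \<in> D" and "p \<noteq> q"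
    and "normalized_complex_geodesic D p q \<phi>"
    and "normalized_complex_geodesic D p q \<psi>"
  shows "\<forall>z\<in>unit_disc. \<phi> z = \<psi> z"
proof
  have D: "open D" "convex D" and ext: "\<And>x. x \<in> frontier D \<Longrightarrow> x extreme_point_of closure D"
    using assms(2) by (auto simp: strictly_convex_domain_def is_domain_def)
  have \<phi>: "holo_on \<phi> unit_disc" "\<phi> ` unit_disc \<subseteq> D" "\<phi> 0 = p"
    and \<psi>: "holo_on \<psi> unit_disc" "\<psi> ` unit_disc \<subseteq> D" "\<psi> 0 = p"
    using assms(7,8)
    by (auto simp: normalized_complex_geodesic_def complex_geodesic_def holo_maps_def)
  have dist_eq: "caratheodory_dist D p q = artanh s"
    if "complex_geodesic D \<eta>" "\<eta> 0 = p" "\<eta> (of_real s) = q" "0 < s" "s < 1" for \<eta> and s :: real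
  proof -
    have "poincare_dist 0 (of_real s) = caratheodory_dist D (\<eta> 0) (\<eta> (of_real s))"
      using that(1,4,5) unfolding complex_geodesic_def by simp
    then show ?thesis using that by (simp add: poincare_dist_0)
  qed
  obtain s where s: "0 < s" "s < 1" "\<phi> (of_real s) = q" "caratheodory_dist D p q = artanh s"
    using assms(7) dist_eq[of \<phi>] unfolding normalized_complex_geodesic_def by blast
  obtain s' where s': "0 < s'" "s' < 1" "\<psi> (of_real s') = q" "caratheodory_dist D p q = artanh s'"
    using assms(8) dist_eq[of \<psi>] unfolding normalized_complex_geodesic_def by blast
  \<comment> \<open>Both parameters have the same \<open>artanh\<close>, namely the Caratheodory
    distance. Hence the midpoint map also takes the value \<open>q\<close> at
    \<open>s\<close>.\<close>
  have "s' = s"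
    using artanh_real_less[of s s'] artanh_real_less[of s' s] s s' by (cases s s' rule: linorder_cases) auto
  \<comment> \<open>The complex scalar makes holomorphy immediate; the real form
    \<open>\<theta>_half\<close> serves convexity.\<close>
  define \<theta> where "\<theta> z = of_real (1 / 2) *\<^sub>C (\<phi> z + \<psi> z)" for z
  have \<theta>_half: "\<theta> z = (1 / 2) *\<^sub>R (\<phi> z + \<psi> z)" for z
    unfolding \<theta>_def by (rule scaleC_of_real)
  have "holo_on \<theta> unit_disc"
    unfolding \<theta>_def by (intro holo_on_scaleC holo_on_add \<phi> \<psi>)
  moreover have "\<theta> z \<in> D" if "z \<in> unit_disc" for z
  proof -
    have "(1 / 2) *\<^sub>R \<phi> z + (1 / 2) *\<^sub>R \<psi> z \<in> D"
      using that \<phi>(2) \<psi>(2) by (intro convexD[OF D(2)]) auto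
    then show ?thesis by (simp add: \<theta>_half scaleR_add_right)
  qed
  ultimately have \<theta>: "\<theta> \<in> holo_maps unit_disc D" by (auto simp: holo_maps_def)
  have \<theta>_0: "\<theta> 0 = p" and \<theta>_s: "\<theta> (of_real s) = q"
    using \<phi>(3) \<psi>(3) s(3) s'(3) \<open>s' = s\<close> by (simp_all add: \<theta>_half scaleR_half_double)
  have bdd: "bounded (\<phi> ` unit_disc)" "bounded (\<psi> ` unit_disc)"
    using \<phi>(2) \<psi>(2) assms(3) bounded_subset by blast+
  \<comment> \<open>The analytic Radon-Nikodym property enters here, with boundedness of
    \<open>D\<close> bounding both maps.\<close>
  have "AE t in lebesgue_on {0..2*pi}. \<exists>l. ((\<lambda>r. \<phi> (of_real r * cis t)) \<longlongrightarrow> l) (at_left 1)"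
    and "AE t in lebesgue_on {0..2*pi}. \<exists>l. ((\<lambda>r. \<psi> (of_real r * cis t)) \<longlongrightarrow> l) (at_left 1)"
    using assms(1) \<phi>(1) \<psi>(1) bdd unfolding analytic_RNP_def by blast+
  then have lim: "AE t in lebesgue_on {0..2*pi}.
    ((\<lambda>r. \<phi> (of_real r * cis t) - \<psi> (of_real r * cis t)) \<longlongrightarrow> 0) (at_left 1)"
  proof eventually_elim
    case (elim t)
    then obtain a b where a: "((\<lambda>r. \<phi> (of_real r * cis t)) \<longlongrightarrow> a) (at_left 1)"
      and b: "((\<lambda>r. \<psi> (of_real r * cis t)) \<longlongrightarrow> b) (at_left 1)"
      by blast
    have ev: "\<forall>\<^sub>F r::real in at_left 1. of_real r * cis t \<in> ball (0::complex) 1"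
      by (rule eventually_at_leftI[of 0]) (auto simp: norm_mult)
    have ev_D: "\<forall>\<^sub>F r in at_left 1. \<eta> (of_real r * cis t) \<in> closure D" if "\<eta> ` unit_disc \<subseteq> D" for \<eta>
      by (rule eventually_mono[OF ev]) (use that closure_subset in blast)
    have cl: "a \<in> closure D" "b \<in> closure D"
      using Lim_in_closed_set[OF closed_closure ev_D _ a] Lim_in_closed_set[OF closed_closure ev_D _ b]
        \<phi>(2) \<psi>(2) by simp_all
    let ?m = "(1 / 2) *\<^sub>R (a + b)"
    have "((\<lambda>r. \<theta> (of_real r * cis t)) \<longlongrightarrow> ?m) (at_left 1)"
      unfolding \<theta>_half by (intro tendsto_intros a b)
    then have "?m \<notin> D"
      by (rule radial_limit_notin_domain[OF D \<theta> \<theta>_0 \<theta>_s s(1,2,4)])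
    moreover have "?m \<in> closure D"
      using convexD[OF convex_closure[OF D(2)] cl, of "1/2" "1/2"] by (simp add: scaleR_add_right)
    \<comment> \<open>As \<open>D\<close> is open, a point of its closure outside \<open>D\<close>
      lies on the frontier.\<close>
    ultimately have "?m extreme_point_of closure D"
      using D(1) by (intro ext) (simp add: frontier_def interior_open)
    \<comment> \<open>An extreme point cannot be the midpoint of two distinct points of the closure,
      which forces \<open>a = b\<close>.\<close>
    then have "?m \<notin> open_segment a b"
      using cl by (auto simp: extreme_point_of_def)
    moreover have "midpoint a b = ?m" by (simp add: midpoint_def)
    ultimately have "a = b" using midpoint_in_open_segment[of a b] by auto
    with tendsto_diff[OF a b] show ?case by simp
  qed
  fix z :: complex assume "z \<in> unit_disc"
  then show "\<phi> z = \<psi> z"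
    by (rule holo_eq_if_radial_limits_eq[OF \<phi>(1) \<psi>(1) bdd lim])
qed

end
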